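(* Let $f(z)=\sum_{n=0}^{\infty} a_n z^n\in\mathcal{B}$, let $\omega\in\mathcal{B}_m$ for some $m\in\mathbb{N}$, and let $p\in(0,2]$. Then for arbitrary $\lambda\in(0,\infty)$ and $z\in\mathbb{D}$ with $|z|=r$, $$E_f(z):=|f(\omega(z))|^p+\lambda\,[B_1(f,r)+A(f_0,r)]\le1\quad\text{for } 0\le r\le R_{\lambda,m},$$ where $R_{\lambda,m}$ is the minimal positive root in $[0,1]$ of the equation $$p\,\frac{1-r^m}{1+r^m}-2\lambda\frac{r}{1-r}=0,$$ and $R_{\lambda,m}$ is the best possible.
   Context: $\mathbb{D}=\{z\in\mathbb{C}:|z|<1\}$ and $\mathbb{N}=\{1,2,\ldots\}$. $\mathcal{B}$ is the set of analytic functions $f$ on $\mathbb{D}$ with $\sup_{z\in\mathbb{D}}|f(z)|\le 1$. For $m\in\mathbb{N}$, $\mathcal{B}_m=\{\omega\in\mathcal{B}:\omega(0)=\cdots=\omega^{(m-1)}(0)=0,\ \omega^{(m)}(0)\ne0\}$. For $f(z)=\sum_{n=0}^\infty a_nz^n\in\mathcal{B}$ put $f_0(z)=f(z)-f(0)$, $$B_1(f,r)=\sum_{n=1}^\infty|a_n|r^n,\qquad \|f_0\|_r^2=\sum_{n=1}^\infty|a_n|^2r^{2n},\qquad A(f_0,r)=\left(\frac1{1+|a_0|}+\frac r{1-r}\right)\|f_0\|_r^2.$$ The number $R_{\lambda,m}$ also depends on $p$. "Best possible" means that, for the given $m,p,\lambda$, $R_{\lambda,m}$ cannot be replaced by a larger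 number: for every $R'\in(R_{\lambda,m},1]$ there exist $f\in\mathcal{B}$, $\omega\in\mathcal{B}_m$ and $z$ with $|z|=r<R'$ such that $E_f(z)>1$. *)

theory Defs
  imports "HOL-Complex_Analysis.Complex_Analysis"
begin

definition schur_class :: "(complex \<Rightarrow> complex) set" where
  "schur_class = {f. f analytic_on ball 0 1 \<and> (\<forall>z\<in>ball 0 1. cmod (f z) \<le> 1)}"

definition schur_class_order :: "nat \<Rightarrow> (complex \<Rightarrow> complex) set" where
  "schur_class_order m =
     {\<omega> \<in> schur_class. (\<forall>k<m. (deriv ^^ k) \<omega> 0 = 0) \<and> (deriv ^^ m) \<omega> 0 \<noteq> 0}"

definition taylor_coeff :: "(complex \<Rightarrow> complex) \<Rightarrow> nat \<Rightarrow> complex" where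
  "taylor_coeff f n = fps_nth (fps_expansion f 0) n"

(* The sums over n >= 1 are written with the index shifted by one. *)

definition bohr_sum :: "(complex \<Rightarrow> complex) \<Rightarrow> real \<Rightarrow> real" where
  "bohr_sum f r = (\<Sum>n. cmod (taylor_coeff f (Suc n)) * r ^ Suc n)"

(* The squared norm of f_0 = f - f(0), as a function of f. *)
definition norm_f0_sq :: "(complex \<Rightarrow> complex) \<Rightarrow> real \<Rightarrow> real" where
  "norm_f0_sq f r = (\<Sum>n. (cmod (taylor_coeff f (Suc n)))\<^sup>2 * r ^ (2 * Suc n))"

(* The quantity A(f_0, r); it takes f because it also involves a_0 = f(0). *)
definition bohr_area :: "(complex \<Rightarrow> complex) \<Rightarrow> real \<Rightarrow> real" where
  "bohr_area f r = (1 / (1 + cmod (taylor_coeff f 0)) + r / (1 - r)) * norm_f0_sq f r"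

definition bohr_E ::
  "real \<Rightarrow> real \<Rightarrow> (complex \<Rightarrow> complex) \<Rightarrow> (complex \<Rightarrow> complex) \<Rightarrow> complex \<Rightarrow> real" where
  "bohr_E p lam f \<omega> z =
     cmod (f (\<omega> z)) powr p + lam * (bohr_sum f (cmod z) + bohr_area f (cmod z))"

(* The equation is meaningless at r = 1; that point is left out because division
   by zero would otherwise make 1 a spurious root. *)
definition radius_root :: "real \<Rightarrow> real \<Rightarrow> nat \<Rightarrow> real \<Rightarrow> bool" where
  "radius_root p lam m r \<longleftrightarrow> 0 < r \<and> r < 1 \<and>
     p * ((1 - r ^ m) / (1 + r ^ m)) - 2 * lam * (r / (1 - r)) = 0"

definition bohr_radius :: "real \<Rightarrow> real \<Rightarrow> nat \<Rightarrow> real" where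
  "bohr_radius p lam m = (LEAST r. radius_root p lam m r)"

end

(*
  Testing the contractivity of the Toeplitz operator of f against suitable vectors gives
  |a_(2k+1)| <= 1 - |a_0|^2 - ... - |a_k|^2 and
  |a_(2k)| <= 1 - |a_0|^2 - ... - |a_(k-1)|^2 - |a_k|^2 / (1 + |a_0|) (Carlson).
  Multiplying by r^n and summing, the quadratic terms add up to exactly A(f_0, r), so that
  B_1(f, r) + A(f_0, r) <= (1 - |a_0|^2) r / (1 - r).  Schwarz-Pick bounds |f(w(z))| by
  x = (|a_0| + t) / (1 + |a_0| t) with t = |w(z)| <= r^m, and concavity of y^(p/2) gives
  x^p <= 1 - p/2 (1 - x^2) <= 1 - p/2 (1 - |a_0|^2) (1 - t) / (1 + t), which makes the sum at
  most 1 as long as the function defining the radius is nonnegative.  For sharpness take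
  f(z) = (a + z) / (1 + a z) and w(z) = z^m at z = r: beyond the radius, the derivative at a = 1 of
  the lower bound for E obtained by dropping A(f_0, r) is negative while its value at a = 1 is 1.
*)

theory Submission
  imports Defs "HOL-Library.Real_Mod"
begin

section \<open>Discrete Parseval identity and multiplication by a bounded polynomial\<close>

text \<open>The summand is \<open>w ^ j\<close> for an N-th root of unity \<open>w\<close>, which
  differs from 1 when n and k differ because 0 < |n - k| < N. The geometric sum over j then
  vanishes.\<close>

lemma sum_roots_of_unity_orthogonal:
  assumes "n < N" "k < N"
  shows "(\<Sum>j<N. cis (2 * pi * real j / real N) ^ n * cnj (cis (2 * pi * real j / real N)) ^ k)
         = (if n = k then of_nat N else 0)"
proof -
  define w where "w = cis (2 * pi * (real n - real k) / real N)"
  have N: "N > 0" using assms by simp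
  have w: "cis (2 * pi * real j / real N) ^ n * cnj (cis (2 * pi * real j / real N)) ^ k = w ^ j" for j
    using N by (simp add: w_def Complex.DeMoivre cis_cnj cis_mult field_simps)
  show ?thesis
  proof (cases "n = k")
    case True
    then show ?thesis unfolding w by (simp add: w_def)
  next
    case False
    have "w \<noteq> 1"
    proof
      assume "w = 1"
      then obtain l :: int where "2 * pi * (real n - real k) / real N = of_int l * (2 * pi)"
        unfolding w_def cis_eq_1_iff by blast
      then have "2 * pi * (real n - real k) = 2 * pi * (of_int l * real N)" using N by (simp add: field_simps)
      then have "real n - real k = of_int l * real N" by (subst (asm) mult_left_cancel) auto
      then have "of_int (int n - int k) = (of_int (l * int N) :: real)" by simp
      then have *: "int n - int k = l * int N" by (simp only: of_int_eq_iff)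
      then have "l \<noteq> 0" using False by auto
      then have "\<bar>int n - int k\<bar> \<ge> int N" unfolding * abs_mult
        using N by simp
      then show False using assms by linarith
    qed
    moreover have "w ^ N = 1"
    proof -
      have "w ^ N = cis (2 * pi * (real n - real k))"
        using N by (simp add: w_def Complex.DeMoivre)
      also have "\<dots> = 1" by (rule cis_multiple_2pi) auto
      finally show ?thesis .
    qed
    ultimately show ?thesis unfolding w using False by (simp add: geometric_sum)
  qed
qed

text \<open>Sampling at N-th roots of unity replaces the mean over the unit circle; it is exact
  because all exponents lie below N.\<close>

lemma parseval_poly:
  assumes "degree P < N"
  shows "(\<Sum>j<N. (cmod (poly P (cis (2 * pi * real j / real N))))\<^sup>2)
         = real N * (\<Sum>n<N. (cmod (coeff P n))\<^sup>2)"
proof -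
  let ?z = "\<lambda>j. cis (2 * pi * real j / real N)"
  have p: "poly P z = (\<Sum>n<N. coeff P n * z ^ n)" for z
  proof -
    have "poly P z = (\<Sum>n\<le>degree P. coeff P n * z ^ n)" by (rule poly_altdef)
    also have "\<dots> = (\<Sum>n<N. coeff P n * z ^ n)"
      by (rule sum.mono_neutral_left) (use assms in \<open>auto simp: coeff_eq_0\<close>)
    finally show ?thesis .
  qed
  have "complex_of_real (\<Sum>j<N. (cmod (poly P (?z j)))\<^sup>2)
      = (\<Sum>j<N. \<Sum>n<N. \<Sum>k<N. coeff P n * cnj (coeff P k) * (?z j ^ n * cnj (?z j) ^ k))"
    unfolding of_real_sum complex_norm_square p cnj_sum sum_product
    by (simp add: mult_ac)
  also have "\<dots> = (\<Sum>n<N. \<Sum>k<N. coeff P n * cnj (coeff P k) * (\<Sum>j<N. ?z j ^ n * cnj (?z j) ^ k))"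
    unfolding sum_distrib_left
    by (subst sum.swap, rule sum.cong[OF refl], rule sum.swap)
  also have "\<dots> = (\<Sum>n<N. \<Sum>k<N. coeff P n * cnj (coeff P k) * (if n = k then of_nat N else 0))"
    by (intro sum.cong refl) (simp only: sum_roots_of_unity_orthogonal lessThan_iff)
  also have "\<dots> = (\<Sum>n<N. \<Sum>k<N. if n = k then of_nat N * (coeff P n * cnj (coeff P k)) else 0)"
    by (intro sum.cong refl) auto
  also have "\<dots> = (\<Sum>n<N. of_nat N * (coeff P n * cnj (coeff P n)))"
    by (intro sum.cong refl) (simp add: sum.delta)
  also have "\<dots> = complex_of_real (real N * (\<Sum>n<N. (cmod (coeff P n))\<^sup>2))"
    by (simp only: of_real_mult of_real_sum complex_norm_square sum_distrib_left of_real_of_nat_eq)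
  finally show ?thesis by (simp only: of_real_eq_iff)
qed

text \<open>Multiplication by \<open>p\<close> has norm at most \<open>M\<close> in the mean square
  over the circle, and dropping the coefficients of \<open>p * g\<close> from \<open>K\<close> on
  only decreases the left side.\<close>

lemma sum_coeff_mult_le:
  assumes "\<And>z. cmod z = 1 \<Longrightarrow> cmod (poly p z) \<le> M" and "degree g < K" and "M \<ge> 0"
  shows "(\<Sum>n<K. (cmod (coeff (p * g) n))\<^sup>2) \<le> M\<^sup>2 * (\<Sum>n<K. (cmod (coeff g n))\<^sup>2)"
proof -
  \<comment> \<open>\<open>N\<close> exceeds the degrees of both \<open>p * g\<close> and
    \<open>g\<close>, so one set of sample points serves Parseval for both.\<close>
  define N where "N = Suc (degree p + K)"
  let ?z = "\<lambda>j. cis (2 * pi * real j / real N)"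
  have N: "degree (p * g) < N" "degree g < N" "K \<le> N" "N > 0"
    using degree_mult_le[of p g] assms(2) by (auto simp: N_def)
  have "real N * (\<Sum>n<K. (cmod (coeff (p * g) n))\<^sup>2) \<le> real N * (\<Sum>n<N. (cmod (coeff (p * g) n))\<^sup>2)"
    using N by (intro mult_left_mono sum_mono2) auto
  also have "\<dots> = (\<Sum>j<N. (cmod (poly (p * g) (?z j)))\<^sup>2)"
    by (rule parseval_poly[symmetric]) fact
  also have "\<dots> \<le> (\<Sum>j<N. M\<^sup>2 * (cmod (poly g (?z j)))\<^sup>2)"
    by (intro sum_mono) (auto simp: norm_mult power_mult_distrib intro!: mult_right_mono power_mono assms(1))
  also have "\<dots> = M\<^sup>2 * (real N * (\<Sum>n<N. (cmod (coeff g n))\<^sup>2))"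
    by (simp only: parseval_poly[OF N(2)] sum_distrib_left[symmetric])
  also have "(\<Sum>n<N. (cmod (coeff g n))\<^sup>2) = (\<Sum>n<K. (cmod (coeff g n))\<^sup>2)"
    by (rule sum.mono_neutral_right) (use assms(2) N in \<open>auto simp: coeff_eq_0\<close>)
  finally show ?thesis using N(4) by simp
qed

section \<open>Toeplitz contraction and Carlson's coefficient inequalities\<close>

lemma schur_sums:
  assumes "f \<in> schur_class" "cmod z < 1"
  shows "(\<lambda>n. taylor_coeff f n * z ^ n) sums f z"
proof -
  have "f holomorphic_on ball 0 1"
    using assms(1) by (auto simp: schur_class_def analytic_imp_holomorphic)
  from holomorphic_power_series[OF this, of z] assms(2) show ?thesis
    by (simp add: taylor_coeff_def fps_expansion_def)
qed

lemma schur_summable: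
  assumes "f \<in> schur_class" "0 \<le> r" "r < 1"
  shows "summable (\<lambda>n. cmod (taylor_coeff f n) * r ^ n)"
proof -
  define s where "s = (1 + r) / 2"
  have s: "r < s" "s < 1" using assms by (auto simp: s_def)
  have "summable (\<lambda>n. taylor_coeff f n * complex_of_real s ^ n)"
    using schur_sums[OF assms(1), of "of_real s"] s assms by (auto simp: sums_iff)
  from powser_insidea[OF this, of "of_real r"] s assms show ?thesis
    by (simp add: norm_mult norm_power)
qed

text \<open>The inner sums are the first \<open>K\<close> coefficients of f times the polynomial
  with coefficients \<open>g\<close>. The bound for polynomial multipliers is applied to Taylor
  truncations of the dilation f(r z); then the truncation order tends to infinity and r to
  1.\<close>

lemma schur_toeplitz_contraction:
  assumes f: "f \<in> schur_class"
  shows "(\<Sum>n<K. (cmod (\<Sum>i\<le>n. taylor_coeff f i * g (n - i)))\<^sup>2) \<le> (\<Sum>n<K. (cmod (g n))\<^sup>2)"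
proof (cases "K = 0")
  case False
  let ?a = "taylor_coeff f"
  define G where "G = (\<Sum>n<K. monom (g n) n)"
  have coeff_G: "coeff G n = (if n < K then g n else 0)" for n
    by (simp add: G_def coeff_sum sum.delta)
  have deg_G: "degree G < K"
    using False by (auto simp: coeff_G intro!: le_less_trans[OF degree_le[of "K - 1"]])
  let ?S = "\<Sum>n<K. (cmod (g n))\<^sup>2"
  have *: "(\<Sum>n<K. (cmod (\<Sum>i\<le>n. ?a i * of_real r ^ i * g (n - i)))\<^sup>2) \<le> ?S"
    if r: "0 < r" "r < 1" for r :: real
  proof -
    let ?b = "\<lambda>n. cmod (?a n) * r ^ n"
    \<comment> \<open>This tail bounds, uniformly on the unit circle, the error of the truncation of
      f(r z) to its first \<open>D\<close> terms.\<close>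
    define e where "e D = suminf ?b - (\<Sum>n<D. ?b n)" for D
    have sb: "summable ?b" using schur_summable[OF f] r by simp
    have e: "e \<longlonglongrightarrow> 0"
      unfolding e_def using tendsto_diff[OF tendsto_const summable_LIMSEQ[OF sb], of "suminf ?b"] by simp
    have e_alt: "e D = (\<Sum>n. ?b (n + D))" for D
      unfolding e_def using suminf_minus_initial_segment[OF sb] by simp
    have e0: "e D \<ge> 0" for D
      unfolding e_alt using r by (intro suminf_nonneg summable_ignore_initial_segment sb) auto
    have bound: "(\<Sum>n<K. (cmod (\<Sum>i\<le>n. ?a i * of_real r ^ i * g (n - i)))\<^sup>2) \<le> (1 + e D)\<^sup>2 * ?S"
      if D: "D \<ge> K" for D
    proof -
      define p where "p = (\<Sum>n<D. monom (?a n * of_real r ^ n) n)"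
      have coeff_p: "coeff p n = (if n < D then ?a n * of_real r ^ n else 0)" for n
        by (simp add: p_def coeff_sum sum.delta)
      have poly_p: "cmod (poly p z) \<le> 1 + e D" if z: "cmod z = 1" for z
      proof -
        let ?c = "\<lambda>n. ?a n * (of_real r * z) ^ n"
        have rz: "cmod (of_real r * z) < 1" using z r by (simp add: norm_mult)
        have nc: "norm (?c n) = ?b n" for n using z r by (simp add: norm_mult norm_power)
        have sums: "?c sums f (of_real r * z)" by (rule schur_sums[OF f rz])
        have "poly p z = (\<Sum>n<D. ?c n)"
          by (simp add: p_def poly_sum poly_monom power_mult_distrib mult_ac)
        also have "\<dots> = f (of_real r * z) - (\<Sum>n. ?c (n + D))"
          using suminf_minus_initial_segment[OF sums_summable[OF sums], of D] sums_unique[OF sums] by simp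
        also have "cmod \<dots> \<le> cmod (f (of_real r * z)) + cmod (\<Sum>n. ?c (n + D))"
          by (rule norm_triangle_ineq4)
        also have "cmod (\<Sum>n. ?c (n + D)) \<le> e D"
          unfolding e_alt
          by (intro norm_suminf_le) (use nc summable_ignore_initial_segment[OF sb] in auto)
        also have "cmod (f (of_real r * z)) \<le> 1"
          using f rz by (auto simp: schur_class_def)
        finally show ?thesis by simp
      qed
      have "(\<Sum>n<K. (cmod (coeff (p * G) n))\<^sup>2) \<le> (1 + e D)\<^sup>2 * (\<Sum>n<K. (cmod (coeff G n))\<^sup>2)"
        by (rule sum_coeff_mult_le[OF poly_p deg_G]) (use e0[of D] in auto)
      also have "(\<Sum>n<K. (cmod (coeff G n))\<^sup>2) = ?S"
        by (simp add: coeff_G)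
      \<comment> \<open>Since \<open>D \<ge> K\<close>, the truncation does not affect any
        coefficient of index below \<open>K\<close>.\<close>
      also have "(\<Sum>n<K. (cmod (coeff (p * G) n))\<^sup>2)
          = (\<Sum>n<K. (cmod (\<Sum>i\<le>n. ?a i * of_real r ^ i * g (n - i)))\<^sup>2)"
        using D by (intro sum.cong refl arg_cong[where f = "\<lambda>x. (cmod x)\<^sup>2"])
          (auto simp: coeff_mult coeff_p coeff_G intro!: sum.cong)
      finally show ?thesis .
    qed
    have "(\<lambda>D. (1 + e D)\<^sup>2 * ?S) \<longlonglongrightarrow> (1 + 0)\<^sup>2 * ?S"
      by (intro tendsto_intros e)
    then show ?thesis
      by (intro tendsto_lowerbound[where F = sequentially]) (auto simp: eventually_sequentially intro: bound)
  qed
  \<comment> \<open>For fixed \<open>K\<close> the left side is continuous in r, so the bound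
    survives the limit at 1.\<close>
  have "((\<lambda>r. \<Sum>n<K. (cmod (\<Sum>i\<le>n. ?a i * of_real r ^ i * g (n - i)))\<^sup>2) \<longlongrightarrow>
      (\<Sum>n<K. (cmod (\<Sum>i\<le>n. ?a i * of_real 1 ^ i * g (n - i)))\<^sup>2)) (at_left 1)"
    by (intro tendsto_intros)
  moreover have "\<forall>\<^sub>F r in at_left 1. (\<Sum>n<K. (cmod (\<Sum>i\<le>n. ?a i * of_real r ^ i * g (n - i)))\<^sup>2) \<le> ?S"
    using eventually_at_left_real[OF zero_less_one] by eventually_elim (use * in auto)
  ultimately show ?thesis
    using tendsto_upperbound by fastforce
qed simp

text \<open>The contraction is tested on \<open>1 + t \<Sum>\<^sub>j w\<^sub>j cnj a\<^sub>j z\<^sup>N\<^sup>-\<^sup>j\<close>. The phase \<open>t\<close> is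
  chosen so that the last coefficient becomes \<open>t (\<bar>a\<^sub>N\<bar> + \<Sum>\<^sub>j w\<^sub>j \<bar>a\<^sub>j\<bar>\<^sup>2)\<close>; the weights are
  \<open>1\<close>, except for \<open>w\<^sub>k = 1 / (1 + \<bar>a\<^sub>0\<bar>)\<close> when \<open>N = 2k\<close>.\<close>

lemma schur_test_coefficients:
  fixes w :: "nat \<Rightarrow> real" and t :: complex
  assumes f: "f \<in> schur_class" and J: "J < N" and t: "cmod t = 1"
  defines "a \<equiv> taylor_coeff f"
  shows "(\<Sum>n\<le>N. (cmod (a n + t * (\<Sum>j\<le>J. if N \<le> n + j then w j * cnj (a j) * a (n + j - N) else 0)))\<^sup>2)
     \<le> 1 + (\<Sum>j\<le>J. (w j)\<^sup>2 * (cmod (a j))\<^sup>2)"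
proof -
  define h where "h n = (if N - J \<le> n \<and> n \<le> N then t * w (N - n) * cnj (a (N - n)) else 0)" for n
  define g where "g n = (if n = 0 then 1 else 0) + h n" for n
  have conv: "(\<Sum>i\<le>n. a i * g (n - i))
      = a n + t * (\<Sum>j\<le>J. if N \<le> n + j then w j * cnj (a j) * a (n + j - N) else 0)"
    if n: "n \<le> N" for n
  proof -
    have "(\<Sum>i\<le>n. a i * g (n - i)) = (\<Sum>i\<le>n. if i = n then a i else 0) + (\<Sum>i\<le>n. a i * h (n - i))"
      unfolding sum.distrib[symmetric] by (intro sum.cong) (auto simp: g_def algebra_simps)
    also have "(\<Sum>i\<le>n. if i = n then a i else 0) = a n" by (simp add: sum.delta)
    also have "(\<Sum>i\<le>n. a i * h (n - i))
        = (\<Sum>i\<in>{i. i \<le> n \<and> N - J \<le> n - i}. a i * (t * w (N - (n - i)) * cnj (a (N - (n - i)))))"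
      by (rule sum.mono_neutral_cong_right) (use n in \<open>auto simp: h_def\<close>)
    also have "\<dots> = (\<Sum>j\<in>{j. j \<le> J \<and> N \<le> n + j}. t * (w j * cnj (a j) * a (n + j - N)))"
      by (rule sum.reindex_bij_witness[where i = "\<lambda>j. n + j - N" and j = "\<lambda>i. N - (n - i)"])
        (use n J in \<open>auto simp: algebra_simps\<close>)
    also have "\<dots> = (\<Sum>j\<le>J. t * (if N \<le> n + j then w j * cnj (a j) * a (n + j - N) else 0))"
      by (rule sum.mono_neutral_cong_left) auto
    finally show ?thesis by (simp add: sum_distrib_left)
  qed
  have "(\<Sum>n<Suc N. (cmod (g n))\<^sup>2) = (cmod (g 0))\<^sup>2 + (\<Sum>n=1..N. (cmod (h n))\<^sup>2)"
    unfolding lessThan_Suc_atMost atMost_atLeast0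
    by (subst sum.atLeast_Suc_atMost) (auto simp: g_def intro!: sum.cong)
  \<comment> \<open>As \<open>J < N\<close>, the support of \<open>h\<close> avoids index 0, so the
    constant term 1 is undisturbed and contributes exactly 1.\<close>
  also have "g 0 = 1" using J by (simp add: g_def h_def)
  also have "(\<Sum>n=1..N. (cmod (h n))\<^sup>2) = (\<Sum>n=N-J..N. (w (N - n))\<^sup>2 * (cmod (a (N - n)))\<^sup>2)"
    by (rule sum.mono_neutral_cong_right) (use J t in \<open>auto simp: h_def norm_mult power_mult_distrib\<close>)
  also have "\<dots> = (\<Sum>j\<le>J. (w j)\<^sup>2 * (cmod (a j))\<^sup>2)"
    by (rule sum.reindex_bij_witness[where i = "\<lambda>j. N - j" and j = "\<lambda>i. N - i"]) (use J in auto)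
  finally have G: "(\<Sum>n<Suc N. (cmod (g n))\<^sup>2) = 1 + (\<Sum>j\<le>J. (w j)\<^sup>2 * (cmod (a j))\<^sup>2)" by simp
  have "(\<Sum>n\<le>N. (cmod (a n + t * (\<Sum>j\<le>J. if N \<le> n + j then w j * cnj (a j) * a (n + j - N) else 0)))\<^sup>2)
      = (\<Sum>n<Suc N. (cmod (\<Sum>i\<le>n. a i * g (n - i)))\<^sup>2)"
    unfolding lessThan_Suc_atMost
    by (rule sum.cong[OF refl], rule arg_cong[OF conv[symmetric], where f = "\<lambda>x. (cmod x)\<^sup>2"]) simp
  also have "\<dots> \<le> 1 + (\<Sum>j\<le>J. (w j)\<^sup>2 * (cmod (a j))\<^sup>2)"
    using schur_toeplitz_contraction[OF f, of g "Suc N"] unfolding G a_def .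
  finally show ?thesis .
qed

text \<open>With all weights 1 the test gives s + (A + s)^2 <= 1 + s: the coefficients up to k
  contribute s, the last one (A + s)^2, and s cancels.\<close>

lemma carlson_inequality_odd:
  assumes f: "f \<in> schur_class"
  defines "a \<equiv> taylor_coeff f"
  shows "cmod (a (2 * k + 1)) \<le> 1 - (\<Sum>j\<le>k. (cmod (a j))\<^sup>2)"
proof -
  define N where "N = 2 * k + 1"
  \<comment> \<open>The default 1 keeps \<open>t\<close> unimodular when \<open>a N\<close> is 0,
    where \<open>sgn\<close> would give 0.\<close>
  define t where "t = (if a N = 0 then 1 else sgn (a N))"
  define A where "A = cmod (a N)"
  define s where "s = (\<Sum>j\<le>k. (cmod (a j))\<^sup>2)"
  define c where "c n = a n + t * (\<Sum>j\<le>k. if N \<le> n + j then complex_of_real 1 * cnj (a j) * a (n + j - N) else 0)" for n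
  have t: "cmod t = 1" "a N = t * complex_of_real A"
    by (simp_all add: t_def norm_sgn A_def) (simp add: sgn_eq)
  \<comment> \<open>For n and j up to k, n + j <= 2k < N, so the test vector leaves these
    coefficients unchanged.\<close>
  have "s = (\<Sum>n\<le>k. (cmod (c n))\<^sup>2)"
    unfolding s_def by (intro sum.cong refl) (auto simp: c_def N_def)
  moreover have "c N = t * complex_of_real (A + s)"
  proof -
    have "c N = a N + t * (\<Sum>j\<le>k. cnj (a j) * a j)" by (simp add: c_def)
    also have "(\<Sum>j\<le>k. cnj (a j) * a j) = complex_of_real s"
      unfolding s_def of_real_sum complex_norm_square by (simp add: mult.commute)
    finally show ?thesis using t(2) by (simp add: algebra_simps)
  qed
  then have "cmod (c N) = \<bar>A + s\<bar>" using t(1) by (simp add: norm_mult del: of_real_add)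
  ultimately have "s + (A + s)\<^sup>2 = (\<Sum>n\<in>{..k} \<union> {N}. (cmod (c n))\<^sup>2)"
    by (subst sum.union_disjoint) (auto simp: N_def)
  also have "\<dots> \<le> (\<Sum>n\<le>N. (cmod (c n))\<^sup>2)"
    by (intro sum_mono2) (auto simp: N_def)
  also have "\<dots> \<le> 1 + s"
    using schur_test_coefficients[OF f _ t(1), of k N "\<lambda>_. 1"]
    unfolding a_def[symmetric] c_def s_def by (simp add: N_def)
  finally have "(A + s)\<^sup>2 \<le> 1" by simp
  then show ?thesis using abs_square_le_1[of "A + s"] by (simp add: N_def A_def s_def)
qed

text \<open>Now N = 2k, so among the coefficients up to k exactly the one at k is perturbed, by a
  multiple of a_0. The weight \<open>b\<close> is chosen so that the lower bound b^2 |a_k|^2 for its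
  square cancels the same term on the right.\<close>

lemma carlson_inequality_even:
  assumes f: "f \<in> schur_class" and k: "k \<ge> 1"
  defines "a \<equiv> taylor_coeff f"
  shows "cmod (a (2 * k)) \<le> 1 - (\<Sum>j<k. (cmod (a j))\<^sup>2) - (cmod (a k))\<^sup>2 / (1 + cmod (a 0))"
proof -
  define N where "N = 2 * k"
  define t where "t = (if a N = 0 then 1 else sgn (a N))"
  define A where "A = cmod (a N)"
  define s where "s = (\<Sum>j<k. (cmod (a j))\<^sup>2)"
  define b where "b = 1 / (1 + cmod (a 0))"
  define w where "w j = (if j = k then b else 1)" for j
  define q where "q = (cmod (a k))\<^sup>2"
  define c where "c n = a n + t * (\<Sum>j\<le>k. if N \<le> n + j then w j * cnj (a j) * a (n + j - N) else 0)" for n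
  have t: "cmod t = 1" "a N = t * complex_of_real A"
    by (simp_all add: t_def norm_sgn A_def) (simp add: sgn_eq)
  \<comment> \<open>The weight is the solution of b = 1 - b |a_0|, so the triangle inequality at
    index k returns b |a_k|.\<close>
  have b: "b \<ge> 0" "1 - b * cmod (a 0) = b"
    by (auto simp: b_def field_simps add_nonneg_eq_0_iff)
  have "s = (\<Sum>n<k. (cmod (c n))\<^sup>2)"
    unfolding s_def by (intro sum.cong refl) (auto simp: c_def N_def)
  moreover have "b\<^sup>2 * q \<le> (cmod (c k))\<^sup>2"
  proof -
    have "(\<Sum>j\<le>k. if N \<le> k + j then w j * cnj (a j) * a (k + j - N) else 0)
        = (\<Sum>j\<le>k. if j = k then b * cnj (a k) * a 0 else 0)"
      by (intro sum.cong refl) (auto simp: N_def w_def)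
    then have ck: "c k = a k + t * (b * cnj (a k) * a 0)"
      by (simp add: c_def)
    have "b * cmod (a k) = (1 - b * cmod (a 0)) * cmod (a k)" using b by simp
    also have "\<dots> = cmod (a k) - cmod (t * (b * cnj (a k) * a 0))"
      using t(1) b by (simp add: norm_mult algebra_simps)
    also have "\<dots> \<le> cmod (c k)"
      unfolding ck by (rule norm_diff_ineq)
    finally show ?thesis using b by (simp add: q_def power_mult_distrib[symmetric])
  qed
  moreover have "c N = t * complex_of_real (A + (s + b * q))"
  proof -
    have "c N = a N + t * (\<Sum>j\<le>k. w j * cnj (a j) * a j)" by (simp add: c_def)
    also have "(\<Sum>j\<le>k. w j * cnj (a j) * a j) = complex_of_real (\<Sum>j\<le>k. w j * (cmod (a j))\<^sup>2)"
      unfolding of_real_sum of_real_mult complex_norm_square by (simp add: mult_ac)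
    also have "(\<Sum>j\<le>k. w j * (cmod (a j))\<^sup>2) = s + b * q"
      by (simp add: lessThan_Suc_atMost[symmetric] w_def s_def q_def)
    finally show ?thesis using t(2) by (simp add: algebra_simps)
  qed
  then have "cmod (c N) = \<bar>A + (s + b * q)\<bar>" using t(1) by (simp add: norm_mult del: of_real_add)
  ultimately have "s + b\<^sup>2 * q + (A + (s + b * q))\<^sup>2
      \<le> (\<Sum>n<k. (cmod (c n))\<^sup>2) + (cmod (c k))\<^sup>2 + (cmod (c N))\<^sup>2" by simp
  also have "\<dots> = (\<Sum>n\<in>{..k} \<union> {N}. (cmod (c n))\<^sup>2)"
    using k by (subst sum.union_disjoint) (auto simp: N_def lessThan_Suc_atMost[symmetric])
  also have "\<dots> \<le> (\<Sum>n\<le>N. (cmod (c n))\<^sup>2)"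
    by (intro sum_mono2) (auto simp: N_def)
  also have "\<dots> \<le> 1 + (\<Sum>j\<le>k. (w j)\<^sup>2 * (cmod (a j))\<^sup>2)"
    using schur_test_coefficients[OF f _ t(1), of k N w] k
    unfolding a_def[symmetric] c_def by (simp add: N_def)
  also have "(\<Sum>j\<le>k. (w j)\<^sup>2 * (cmod (a j))\<^sup>2) = s + b\<^sup>2 * q"
    by (simp add: lessThan_Suc_atMost[symmetric] w_def s_def q_def)
  finally have "(A + (s + b * q))\<^sup>2 \<le> 1" by simp
  then have "A + (s + b * q) \<le> 1" using abs_square_le_1[of "A + (s + b * q)"] by simp
  then show ?thesis by (simp add: N_def A_def s_def b_def q_def)
qed

lemma sum_even_atMost:
  fixes F :: "nat \<Rightarrow> 'a::comm_monoid_add"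
  shows "(\<Sum>i\<le>2 * k + 1. if even i then F (i div 2) else 0) = (\<Sum>j\<le>k. F j)"
  by (induction k) (simp_all add: atMost_Suc add_ac)

text \<open>Both Carlson inequalities are written with one convolution, so that summing over \<open>n\<close>
  becomes a Cauchy product of two power series.\<close>

lemma carlson_inequality:
  assumes f: "f \<in> schur_class" and n: "n \<ge> 1"
  defines "a \<equiv> taylor_coeff f"
  defines "u \<equiv> \<lambda>i. if even i \<and> 0 < i then (cmod (a (i div 2)))\<^sup>2 else 0"
  defines "v \<equiv> \<lambda>i. if i = 0 then 1 / (1 + cmod (a 0)) else (1::real)"
  shows "cmod (a n) + (\<Sum>i\<le>n. u i * v (n - i)) \<le> 1 - (cmod (a 0))\<^sup>2"
proof -
  let ?U = "\<lambda>j. if 0 < j then (cmod (a j))\<^sup>2 else 0"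
  have u: "u i = (if even i then ?U (i div 2) else 0)" for i
    by (auto simp: u_def)
  \<comment> \<open>\<open>u\<close> vanishes at 0, and the missing |a_0|^2 is the term on the right
    of the claim.\<close>
  have sum_u: "(\<Sum>i\<le>2 * k + 1. u i) = (\<Sum>j\<le>k. (cmod (a j))\<^sup>2) - (cmod (a 0))\<^sup>2" for k
    unfolding u sum_even_atMost by (induction k) auto
  show ?thesis
  proof (cases "even n")
    case False
    then obtain k where k: "n = 2 * k + 1" by (elim oddE)
    have "(\<Sum>i\<le>n. u i * v (n - i)) = (\<Sum>i\<le>2 * k + 1. u i)"
      unfolding k by (intro sum.cong refl) (auto simp: u v_def)
    then show ?thesis
      using carlson_inequality_odd[OF f, of k] sum_u[of k] unfolding k a_def by linarith
  next
    case True
    then obtain k where k: "n = 2 * k" "k \<ge> 1" using n by (elim evenE) auto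
    obtain l where l: "k = Suc l" using k by (cases k) auto
    \<comment> \<open>Only the last term i = n meets the exceptional value \<open>v 0\<close>; it
      supplies Carlson's weighted |a_k|^2.\<close>
    have "(\<Sum>i\<le>n. u i * v (n - i)) = (\<Sum>i\<le>2 * l + 1. u i * v (n - i)) + u n * v 0"
      by (simp add: k l)
    also have "(\<Sum>i\<le>2 * l + 1. u i * v (n - i)) = (\<Sum>i\<le>2 * l + 1. u i)"
      unfolding k l by (intro sum.cong refl) (auto simp: v_def)
    also have "u n * v 0 = (cmod (a k))\<^sup>2 / (1 + cmod (a 0))"
      using k by (simp add: u_def v_def)
    finally show ?thesis
      using carlson_inequality_even[OF f k(2)] sum_u[of l]
      unfolding k(1) a_def l lessThan_Suc_atMost by linarith
  qed
qed

section \<open>Summing Carlson's inequalities: the estimate for B_1 + A\<close>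

text \<open>The Toeplitz contraction applied to the unit vector \<open>d\<close> bounds the sum of
  squared coefficients by 1.\<close>

lemma taylor_coeff_schur_le_1:
  assumes "f \<in> schur_class"
  shows "cmod (taylor_coeff f n) \<le> 1"
proof -
  define d :: "nat \<Rightarrow> complex" where "d i = (if i = 0 then 1 else 0)" for i
  have "(\<Sum>i\<le>k. taylor_coeff f i * d (k - i)) = (\<Sum>i\<le>k. if i = k then taylor_coeff f i else 0)" for k
    by (intro sum.cong) (auto simp: d_def)
  moreover have "(\<Sum>k<Suc n. (cmod (d k))\<^sup>2) = (\<Sum>k<Suc n. if k = 0 then 1 else 0)"
    by (intro sum.cong) (auto simp: d_def)
  ultimately have "(\<Sum>k<Suc n. (cmod (taylor_coeff f k))\<^sup>2) \<le> 1"
    using schur_toeplitz_contraction[OF assms, of d "Suc n"]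
    by (simp add: sum.delta del: sum.lessThan_Suc)
  moreover have "(cmod (taylor_coeff f n))\<^sup>2 \<le> (\<Sum>k<Suc n. (cmod (taylor_coeff f k))\<^sup>2)"
    by (simp add: sum_nonneg)
  ultimately have "(cmod (taylor_coeff f n))\<^sup>2 \<le> 1" by linarith
  then show ?thesis by (simp add: abs_square_le_1)
qed

lemma norm_f0_sq_sums:
  assumes f: "f \<in> schur_class" and r: "0 \<le> r" "r < 1"
  shows "(\<lambda>n. (cmod (taylor_coeff f (Suc n)))\<^sup>2 * r ^ (2 * Suc n)) sums norm_f0_sq f r"
proof -
  have "summable (\<lambda>n. (cmod (taylor_coeff f (Suc n)))\<^sup>2 * r ^ (2 * Suc n))"
  proof (rule summable_comparison_test')
    show "summable (\<lambda>n. r ^ n)" using r by (simp add: summable_geometric)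
    fix n
    have "(cmod (taylor_coeff f (Suc n)))\<^sup>2 \<le> 1"
      using taylor_coeff_schur_le_1[OF f] by (simp add: abs_square_le_1)
    moreover have "r ^ (2 * Suc n) \<le> r ^ n" using r by (intro power_decreasing) auto
    ultimately have "(cmod (taylor_coeff f (Suc n)))\<^sup>2 * r ^ (2 * Suc n) \<le> 1 * r ^ n"
      using r by (intro mult_mono) auto
    moreover have "0 \<le> (cmod (taylor_coeff f (Suc n)))\<^sup>2 * r ^ (2 * Suc n)"
      using r by (intro mult_nonneg_nonneg) auto
    ultimately show "norm ((cmod (taylor_coeff f (Suc n)))\<^sup>2 * r ^ (2 * Suc n)) \<le> r ^ n"
      by (simp only: real_norm_def abs_of_nonneg mult_1)
  qed
  then show ?thesis unfolding norm_f0_sq_def by (rule summable_sums)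
qed

lemma bohr_area_nonneg:
  assumes "f \<in> schur_class" "0 \<le> r" "r < 1"
  shows "0 \<le> bohr_area f r"
proof -
  have "0 \<le> norm_f0_sq f r"
    by (rule sums_le[OF _ sums_zero norm_f0_sq_sums[OF assms]]) (use assms in auto)
  moreover have "0 \<le> 1 / (1 + cmod (taylor_coeff f 0)) + r / (1 - r)"
    using assms by (intro add_nonneg_nonneg divide_nonneg_nonneg) auto
  ultimately show ?thesis unfolding bohr_area_def by simp
qed

lemma bohr_sum_sums:
  assumes "f \<in> schur_class" "0 \<le> r" "r < 1"
  shows "(\<lambda>n. cmod (taylor_coeff f (Suc n)) * r ^ Suc n) sums bohr_sum f r"
  unfolding bohr_sum_def
  using schur_summable[OF assms] summable_Suc_iff[of "\<lambda>n. cmod (taylor_coeff f n) * r ^ n"]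
  by (auto intro: summable_sums)

text \<open>The two factors of \<open>bohr_area\<close> are the sums of the power series with
  coefficients \<open>u\<close> and \<open>v\<close>. Their Cauchy product has the convolutions of
  \<open>carlson_inequality\<close> as coefficients, so the estimate holds term by term against a
  geometric series.\<close>

lemma bohr_sum_area_le:
  assumes f: "f \<in> schur_class" and r: "0 \<le> r" "r < 1"
  shows "bohr_sum f r + bohr_area f r \<le> (1 - (cmod (taylor_coeff f 0))\<^sup>2) * (r / (1 - r))"
proof -
  let ?a = "taylor_coeff f"
  define u where "u i = (if even i \<and> 0 < i then (cmod (?a (i div 2)))\<^sup>2 else 0)" for i
  define v where "v i = (if i = 0 then 1 / (1 + cmod (?a 0)) else 1)" for i :: nat
  have geom: "(\<lambda>n. r ^ Suc n) sums (r / (1 - r))"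
    using sums_mult[OF geometric_sums[of r], of r] r by simp
  have u_sums: "(\<lambda>i. u i * r ^ i) sums norm_f0_sq f r"
  proof -
    have "(\<lambda>n. u (2 * Suc n) * r ^ (2 * Suc n)) sums norm_f0_sq f r"
      using norm_f0_sq_sums[OF f r] by (simp add: u_def)
    then show ?thesis
    proof (subst (asm) sums_mono_reindex[of "\<lambda>n. 2 * Suc n" "\<lambda>i. u i * r ^ i"])
      show "strict_mono (\<lambda>n. 2 * Suc n)" by (auto simp: strict_mono_def)
      fix i assume "i \<notin> range (\<lambda>n. 2 * Suc n)"
      moreover have "i \<in> range (\<lambda>n. 2 * Suc n)" if "even i" "0 < i"
        using that by (intro image_eqI[of _ _ "i div 2 - 1"]) auto
      ultimately show "u i * r ^ i = 0" by (auto simp: u_def)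
    qed
  qed
  have v_sums: "(\<lambda>i. v i * r ^ i) sums (1 / (1 + cmod (?a 0)) + r / (1 - r))"
    using geom sums_Suc_iff[of "\<lambda>i. v i * r ^ i" "r / (1 - r)"] by (simp add: v_def add.commute)
  have nonneg: "u i * r ^ i \<ge> 0" "v i * r ^ i \<ge> 0" for i
    using r by (auto simp: u_def v_def)
  have "(\<lambda>n. \<Sum>i\<le>n. (u i * r ^ i) * (v (n - i) * r ^ (n - i))) sums
      ((\<Sum>i. u i * r ^ i) * (\<Sum>i. v i * r ^ i))"
    by (rule Cauchy_product_sums) (use u_sums v_sums nonneg in \<open>auto simp: sums_iff\<close>)
  moreover have "(\<Sum>i. u i * r ^ i) * (\<Sum>i. v i * r ^ i) = bohr_area f r"
    using u_sums v_sums by (simp add: sums_iff bohr_area_def mult.commute)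
  moreover have "(\<lambda>n. \<Sum>i\<le>n. (u i * r ^ i) * (v (n - i) * r ^ (n - i)))
      = (\<lambda>n. (\<Sum>i\<le>n. u i * v (n - i)) * r ^ n)"
  proof
    fix n
    have "(u i * r ^ i) * (v (n - i) * r ^ (n - i)) = u i * v (n - i) * r ^ n" if "i \<le> n" for i
    proof -
      have "r ^ n = r ^ i * r ^ (n - i)" using that by (simp add: power_add[symmetric])
      then show ?thesis by (simp only: mult_ac)
    qed
    then show "(\<Sum>i\<le>n. (u i * r ^ i) * (v (n - i) * r ^ (n - i))) = (\<Sum>i\<le>n. u i * v (n - i)) * r ^ n"
      unfolding sum_distrib_right by (intro sum.cong) auto
  qed
  \<comment> \<open>The product series starts at index 0 with a zero term; dropping it aligns the
    index with that of \<open>bohr_sum\<close>.\<close>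
  moreover have sum_0: "(\<Sum>i\<le>0. u i * v (0 - i)) = 0" by (simp add: u_def)
  ultimately have "(\<lambda>n. (\<Sum>i\<le>Suc n. u i * v (Suc n - i)) * r ^ Suc n) sums bohr_area f r"
    using sums_Suc_iff[of "\<lambda>n. (\<Sum>i\<le>n. u i * v (n - i)) * r ^ n" "bohr_area f r"]
    by (simp only: sum_0 mult_zero_left add_0_right)
  from sums_add[OF bohr_sum_sums[OF f r] this] sums_mult[OF geom]
  show ?thesis
  proof (rule sums_le[rotated])
    fix n
    have "(cmod (?a (Suc n)) + (\<Sum>i\<le>Suc n. u i * v (Suc n - i))) * r ^ Suc n
        \<le> (1 - (cmod (?a 0))\<^sup>2) * r ^ Suc n"
      using carlson_inequality[OF f, of "Suc n"] r unfolding u_def v_def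
      by (intro mult_right_mono) auto
    then show "cmod (?a (Suc n)) * r ^ Suc n + (\<Sum>i\<le>Suc n. u i * v (Suc n - i)) * r ^ Suc n
        \<le> (1 - (cmod (?a 0))\<^sup>2) * r ^ Suc n"
      by (simp only: distrib_right)
  qed
qed

section \<open>Schwarz lemma of order m and Schwarz-Pick bound\<close>

lemma schur_class_iff_holomorphic:
  "f \<in> schur_class \<longleftrightarrow> f holomorphic_on ball 0 1 \<and> (\<forall>z\<in>ball 0 1. cmod (f z) \<le> 1)"
  by (simp add: schur_class_def analytic_on_open)

text \<open>Schwarz's argument: w(x) = x^m F(x) with F holomorphic, the maximum principle on |x| =
  rho gives |F| <= 1 / rho^m, and rho tends to 1.\<close>

lemma schur_power_bound:
  assumes w: "w \<in> schur_class" and zero: "\<And>k. k < m \<Longrightarrow> taylor_coeff w k = 0" and z: "cmod z < 1"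
  shows "cmod (w z) \<le> cmod z ^ m"
proof -
  define F where "F = fps_shift m (fps_expansion w 0)"
  have F_nth: "fps_nth F n = taylor_coeff w (n + m)" for n
    by (simp add: F_def taylor_coeff_def)
  have factor: "w x = x ^ m * eval_fps F x \<and> summable (\<lambda>n. fps_nth F n * x ^ n)" if x: "cmod x < 1" for x
  \<comment> \<open>At this point x^m = 0 cannot be cancelled, so the origin is treated
    separately.\<close>
  proof (cases "x = 0 \<and> m > 0")
    case True
    then show ?thesis
      using schur_sums[OF w, of 0] zero[of 0] powser_sums_zero_iff[of "taylor_coeff w" "w 0"] by simp
  next
    case False
    have "(\<lambda>n. taylor_coeff w (n + m) * x ^ (n + m)) sums (w x - (\<Sum>i<m. taylor_coeff w i * x ^ i))"
      using schur_sums[OF w x] by (rule sums_iff_shift'[THEN iffD2])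
    then have s: "(\<lambda>n. x ^ m * (fps_nth F n * x ^ n)) sums w x"
      by (simp add: zero F_nth power_add mult_ac)
    then have "summable (\<lambda>n. fps_nth F n * x ^ n)"
      using False by (cases "m = 0") (auto simp: sums_iff summable_cmult_iff)
    then show ?thesis using s by (simp add: sums_iff eval_fps_def suminf_mult)
  qed
  have rad: "1 \<le> fps_conv_radius F"
    unfolding fps_conv_radius_def
  proof (rule conv_radius_geI_ex')
    fix r :: real assume "0 < r" "ereal r < 1"
    then show "summable (\<lambda>n. fps_nth F n * of_real r ^ n)"
      using factor[of "of_real r"] by simp
  qed
  have hol: "eval_fps F holomorphic_on ball 0 1"
  proof (rule holomorphic_on_eval_fps)
    show "ball (0::complex) 1 \<subseteq> eball 0 (fps_conv_radius F)"
    proof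
      fix x :: complex assume "x \<in> ball 0 1"
      then have "ereal (dist 0 x) < 1" by simp
      from less_le_trans[OF this rad] show "x \<in> eball 0 (fps_conv_radius F)" by simp
    qed
  qed
  have *: "cmod (w z) * \<rho> ^ m \<le> cmod z ^ m" if \<rho>: "cmod z < \<rho>" "\<rho> < 1" for \<rho>
  proof -
    have \<rho>0: "\<rho> > 0" using \<rho> norm_ge_zero[of z] by linarith
    have "cmod (eval_fps F z) \<le> 1 / \<rho> ^ m"
    proof (rule maximum_modulus_frontier[of "eval_fps F" "cball 0 \<rho>"])
      show "eval_fps F holomorphic_on interior (cball 0 \<rho>)"
        using \<rho> by (intro holomorphic_on_subset[OF hol]) auto
      show "continuous_on (closure (cball 0 \<rho>)) (eval_fps F)"
        using \<rho> by (intro holomorphic_on_imp_continuous_on holomorphic_on_subset[OF hol]) auto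
      fix x assume "x \<in> frontier (cball (0::complex) \<rho>)"
      then have x: "cmod x = \<rho>" by simp
      have "\<rho> ^ m * cmod (eval_fps F x) = cmod (w x)"
        using factor[of x] x \<rho> by (simp add: norm_mult norm_power)
      also have "\<dots> \<le> 1" using w x \<rho> by (simp add: schur_class_iff_holomorphic)
      finally show "cmod (eval_fps F x) \<le> 1 / \<rho> ^ m" using \<rho>0 by (simp add: field_simps)
    qed (use \<rho> in auto)
    then have "cmod z ^ m * (cmod (eval_fps F z) * \<rho> ^ m) \<le> cmod z ^ m * 1"
      using \<rho>0 by (intro mult_left_mono) (auto simp: field_simps)
    then show ?thesis using factor[OF z] by (simp add: norm_mult norm_power mult_ac)
  qed
  have "((\<lambda>\<rho>. cmod (w z) * \<rho> ^ m) \<longlongrightarrow> cmod (w z) * 1 ^ m) (at_left 1)"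
    by (intro tendsto_intros)
  moreover have "\<forall>\<^sub>F \<rho> in at_left 1. cmod (w z) * \<rho> ^ m \<le> cmod z ^ m"
    using eventually_at_left_real[OF z] by eventually_elim (use * in auto)
  ultimately have "cmod (w z) * 1 ^ m \<le> cmod z ^ m"
    by (intro tendsto_upperbound) auto
  then show ?thesis by simp
qed

lemma cmod_diff_sq: "(cmod (x - y))\<^sup>2 = (cmod x)\<^sup>2 + (cmod y)\<^sup>2 - 2 * Re (cnj y * x)"
  unfolding cmod_power2 by (simp add: power2_eq_square algebra_simps)

lemma cmod_one_minus_sq:
  "(cmod (1 - cnj c * w))\<^sup>2 = 1 + (cmod c)\<^sup>2 * (cmod w)\<^sup>2 - 2 * Re (cnj c * w)"
  using cmod_diff_sq[of 1 "cnj c * w"] by (simp add: norm_mult power_mult_distrib algebra_simps)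

text \<open>The difference of the squares is (1 - |c|^2) (1 - |w|^2).\<close>

lemma moebius_bound:
  assumes "cmod c \<le> 1" "cmod w \<le> 1"
  shows "cmod (w - c) \<le> cmod (1 - cnj c * w)"
proof -
  have "0 \<le> (1 - (cmod c)\<^sup>2) * (1 - (cmod w)\<^sup>2)"
    using assms by (intro mult_nonneg_nonneg) (auto simp: abs_square_le_1)
  then have "(cmod (w - c))\<^sup>2 \<le> (cmod (1 - cnj c * w))\<^sup>2"
    unfolding cmod_one_minus_sq unfolding cmod_diff_sq by (simp add: algebra_simps)
  then show ?thesis by (rule power2_le_imp_le) simp
qed

text \<open>The Schwarz lemma is applied to f followed by the disc automorphism taking f(0) to 0.
  Squaring and bounding the real part leaves an inequality between moduli alone.\<close>

lemma schwarz_pick_bound: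
  assumes f: "f \<in> schur_class" and w: "cmod w < 1"
  shows "cmod (f w) \<le> (cmod (f 0) + cmod w) / (1 + cmod (f 0) * cmod w)"
proof -
  define c a t x where "c = f 0" and "a = cmod c" and "t = cmod w" and "x = cmod (f w)"
  have b: "0 \<le> a" "a \<le> 1" "0 \<le> t" "t < 1" "0 \<le> x" "x \<le> 1"
    using f w by (auto simp: schur_class_iff_holomorphic c_def a_def t_def x_def)
  show ?thesis
  \<comment> \<open>For a = 1 the automorphism degenerates, but the right side is then 1.\<close>
  proof (cases "a = 1")
    case True
    then show ?thesis using b by (simp add: a_def[symmetric] c_def[symmetric] x_def[symmetric] t_def[symmetric])
  next
    case False
    define g where "g z = (f z - c) / (1 - cnj c * f z)" for z
    have nz: "1 - cnj c * f z \<noteq> 0" if "cmod z < 1" for z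
    proof -
      have "cmod (cnj c * f z) \<le> a * 1"
        unfolding norm_mult complex_mod_cnj a_def
        using f that by (intro mult_left_mono) (auto simp: schur_class_iff_holomorphic)
      also have "\<dots> < 1" using b False by simp
      finally show ?thesis by auto
    qed
    have "g \<in> schur_class"
      unfolding schur_class_iff_holomorphic
    proof
      show "g holomorphic_on ball 0 1"
        unfolding g_def using f nz by (intro holomorphic_intros) (auto simp: schur_class_iff_holomorphic)
      show "\<forall>z\<in>ball 0 1. cmod (g z) \<le> 1"
        using f b nz moebius_bound[of c] by (auto simp: g_def norm_divide schur_class_iff_holomorphic a_def)
    qed
    then have "cmod (g w) \<le> t ^ 1"
      unfolding t_def
      by (rule schur_power_bound) (use w in \<open>auto simp: taylor_coeff_def fps_expansion_def g_def c_def\<close>)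
    then have "cmod (f w - c) \<le> t * cmod (1 - cnj c * f w)"
      using nz[OF w] by (simp add: g_def norm_divide divide_le_eq)
    then have "(cmod (f w - c))\<^sup>2 \<le> t\<^sup>2 * (cmod (1 - cnj c * f w))\<^sup>2"
      unfolding power_mult_distrib[symmetric] by (rule power_mono) simp
    then have "x\<^sup>2 + a\<^sup>2 - t\<^sup>2 * (1 + a\<^sup>2 * x\<^sup>2) \<le> 2 * (1 - t\<^sup>2) * Re (cnj c * f w)"
      unfolding cmod_one_minus_sq unfolding cmod_diff_sq a_def x_def by (simp add: algebra_simps)
    also have "\<dots> \<le> 2 * (1 - t\<^sup>2) * (a * x)"
      using complex_Re_le_cmod[of "cnj c * f w"] b
      by (intro mult_left_mono) (auto simp: norm_mult a_def x_def abs_square_le_1)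
    \<comment> \<open>Replacing the real part by its bound a x completes the square on both
      sides.\<close>
    finally have "(x - a)\<^sup>2 \<le> (t * (1 - a * x))\<^sup>2"
      by (simp add: power2_eq_square algebra_simps)
    moreover have "0 \<le> t * (1 - a * x)" using b by (simp add: mult_le_one)
    ultimately have "x - a \<le> t * (1 - a * x)" by (rule power2_le_imp_le)
    then have "x * (1 + a * t) \<le> a + t" by (simp add: algebra_simps)
    then have "x \<le> (a + t) / (1 + a * t)" using b by (simp add: le_divide_eq add_pos_nonneg)
    then show ?thesis by (simp add: x_def a_def c_def t_def)
  qed
qed

section \<open>Scalar inequalities and the radius equation\<close>

text \<open>The right side is the tangent at y = 1 of the concave function y^(p/2), taken at y =
  x^2. Weighted Young with second factor 1 proves it, and p <= 2 makes the second weight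
  nonnegative.\<close>

lemma powr_tangent_bound:
  fixes x p :: real
  assumes "0 \<le> x" "0 < p" "p \<le> 2"
  shows "x powr p \<le> 1 + p / 2 * (x\<^sup>2 - 1)"
proof (cases "x = 0")
  case False
  then have x: "x > 0" using assms by simp
  have "(x\<^sup>2) powr (p / 2) * 1 powr (1 - p / 2) \<le> p / 2 * x\<^sup>2 + (1 - p / 2) * 1"
    using assms x by (intro Youngs_inequality_0) auto
  moreover have "(x\<^sup>2) powr (p / 2) = x powr p"
    using x by (simp add: powr_powr flip: powr_numeral)
  ultimately show ?thesis by (simp add: algebra_simps)
qed (use assms in auto)

text \<open>Extracts the factor 1 - a^2, matching \<open>bohr_sum_area_le\<close>; the loss comes
  from replacing 1 + a t by 1 + t.\<close>

lemma powr_moebius_bound: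
  fixes a t x p :: real
  assumes a: "0 \<le> a" "a \<le> 1" and t: "0 \<le> t" "t < 1" and x: "0 \<le> x" "x \<le> (a + t) / (1 + a * t)"
    and p: "0 < p" "p \<le> 2"
  shows "x powr p + p / 2 * ((1 - a\<^sup>2) * ((1 - t) / (1 + t))) \<le> 1"
proof -
  define y where "y = (a + t) / (1 + a * t)"
  have d: "0 < 1 + a * t" "1 + a * t \<le> 1 + t"
    using a t by (auto simp: add_pos_nonneg mult_left_le_one_le)
  have "1 - y\<^sup>2 = (1 - a\<^sup>2) * (1 - t\<^sup>2) / (1 + a * t)\<^sup>2"
    unfolding y_def using d by (simp add: power_divide divide_simps) (simp add: power2_eq_square algebra_simps)
  also have "\<dots> \<ge> (1 - a\<^sup>2) * (1 - t\<^sup>2) / (1 + t)\<^sup>2"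
    using d a t by (intro divide_left_mono power_mono mult_nonneg_nonneg mult_pos_pos) (auto simp: abs_square_le_1)
  also have "(1 - a\<^sup>2) * (1 - t\<^sup>2) / (1 + t)\<^sup>2 = (1 - a\<^sup>2) * ((1 - t) / (1 + t))"
    using t by (simp add: divide_simps) (simp add: power2_eq_square algebra_simps)
  finally have "(1 - a\<^sup>2) * ((1 - t) / (1 + t)) \<le> 1 - y\<^sup>2" .
  moreover have "x\<^sup>2 \<le> y\<^sup>2" using x by (intro power_mono) (auto simp: y_def)
  ultimately have "p / 2 * ((1 - a\<^sup>2) * ((1 - t) / (1 + t))) \<le> p / 2 * (1 - x\<^sup>2)"
    using p by (intro mult_left_mono) auto
  moreover have "p / 2 * (x\<^sup>2 - 1) = - (p / 2 * (1 - x\<^sup>2))" by (simp add: algebra_simps)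
  ultimately show ?thesis using powr_tangent_bound[OF x(1) p] by linarith
qed

text \<open>Strictness comes from r / (1 - r). It yields uniqueness of the root and the sign on
  either side of it.\<close>

lemma radius_function_strict_antimono:
  fixes p lam r s :: real
  assumes "0 < p" "0 < lam" "0 \<le> r" "r < s" "s < 1"
  shows "p * ((1 - s ^ m) / (1 + s ^ m)) - 2 * lam * (s / (1 - s))
       < p * ((1 - r ^ m) / (1 + r ^ m)) - 2 * lam * (r / (1 - r))"
proof -
  have "r ^ m \<le> s ^ m" using assms by (intro power_mono) auto
  moreover have "s ^ m \<le> 1" using assms by (intro power_le_one) auto
  moreover have "0 \<le> r ^ m" using assms by simp
  ultimately have "(1 - s ^ m) / (1 + s ^ m) \<le> (1 - r ^ m) / (1 + r ^ m)"
    by (intro frac_le) auto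
  moreover have "r / (1 - r) < s / (1 - s)"
    using assms by (simp add: divide_simps algebra_simps)
  ultimately have "p * ((1 - s ^ m) / (1 + s ^ m)) \<le> p * ((1 - r ^ m) / (1 + r ^ m))"
    "2 * lam * (r / (1 - r)) < 2 * lam * (s / (1 - s))"
    using assms by (auto intro!: mult_left_mono mult_strict_left_mono simp del: times_divide_eq_right)
  then show ?thesis by linarith
qed

lemma radius_root_exists:
  fixes p lam :: real
  assumes "1 \<le> m" "0 < p" "0 < lam"
  shows "\<exists>r. radius_root p lam m r"
proof -
  \<comment> \<open>Clearing denominators removes the singularity at 1, so the intermediate value
    theorem applies on the closed interval; the end values are p and -4 \<open>lam\<close>.\<close>
  define \<psi> where "\<psi> r = p * (1 - r ^ m) * (1 - r) - 2 * lam * r * (1 + r ^ m)" for r :: real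
  have ends: "\<psi> 0 > 0" "\<psi> 1 < 0" using assms by (auto simp: \<psi>_def power_0_left)
  have "continuous_on {0..1} \<psi>" unfolding \<psi>_def by (intro continuous_intros)
  with ends obtain r where r: "0 \<le> r" "r \<le> 1" "\<psi> r = 0"
    using IVT2'[of \<psi> 1 0 0] by auto
  then have "r \<noteq> 0" "r \<noteq> 1" using ends by auto
  with r have r01: "0 < r" "r < 1" by auto
  then have "1 + r ^ m > 0" by (simp add: add_pos_pos)
  then have "p * ((1 - r ^ m) / (1 + r ^ m)) - 2 * lam * (r / (1 - r)) = \<psi> r / ((1 + r ^ m) * (1 - r))"
    using r01 by (simp add: \<psi>_def divide_simps)
  then show ?thesis using r01 r by (auto simp: radius_root_def)
qed

lemma radius_root_unique:
  assumes "0 < p" "0 < lam" "radius_root p lam m r" "radius_root p lam m s"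
  shows "r = s"
  using radius_function_strict_antimono[of p lam r s m] radius_function_strict_antimono[of p lam s r m] assms
  by (cases r s rule: linorder_cases) (auto simp: radius_root_def)

section \<open>The inequality up to the radius\<close>

lemma bohr_E_le_1:
  assumes f: "f \<in> schur_class" and w: "w \<in> schur_class_order m" and m: "1 \<le> m"
    and p: "0 < p" "p \<le> 2" and lam: "0 < lam"
    and R: "radius_root p lam m R" and z: "cmod z \<le> R"
  shows "bohr_E p lam f w z \<le> 1"
proof -
  define r a t where "r = cmod z" and "a = cmod (f 0)" and "t = cmod (w z)"
  have r: "0 \<le> r" "r \<le> R" "R < 1" "r < 1"
    using z R by (auto simp: r_def radius_root_def)
  have a: "0 \<le> a" "a \<le> 1" using f by (auto simp: a_def schur_class_iff_holomorphic)
  have a0: "cmod (taylor_coeff f 0) = a" by (simp add: a_def taylor_coeff_def fps_expansion_def)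
  have "t \<le> r ^ m"
    unfolding t_def r_def using w r
    by (intro schur_power_bound) (auto simp: schur_class_order_def taylor_coeff_def fps_expansion_def r_def)
  \<comment> \<open>With m >= 1 this gives t < 1, as the Schwarz-Pick bound at \<open>w z\<close>
    requires.\<close>
  moreover have "r ^ m \<le> r ^ 1" using r m by (intro power_decreasing) auto
  ultimately have t: "0 \<le> t" "t \<le> r ^ m" "t < 1" using r by (auto simp: t_def)
  have "p * ((1 - r ^ m) / (1 + r ^ m)) - 2 * lam * (r / (1 - r)) \<ge> 0"
    using radius_function_strict_antimono[of p lam r R m] p lam r R
    by (cases "r = R") (auto simp: radius_root_def)
  moreover have "(1 - r ^ m) / (1 + r ^ m) \<le> (1 - t) / (1 + t)"
    using t r by (intro frac_le) (auto simp: power_le_one)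
  then have "p * ((1 - r ^ m) / (1 + r ^ m)) \<le> p * ((1 - t) / (1 + t))"
    using p by (intro mult_left_mono) auto
  ultimately have "2 * lam * (r / (1 - r)) \<le> p * ((1 - t) / (1 + t))" by linarith
  then have "lam * (r / (1 - r)) \<le> p / 2 * ((1 - t) / (1 + t))" by linarith
  then have "(1 - a\<^sup>2) * (lam * (r / (1 - r))) \<le> (1 - a\<^sup>2) * (p / 2 * ((1 - t) / (1 + t)))"
    using a by (intro mult_left_mono) (auto simp: abs_square_le_1)
  moreover have "lam * (bohr_sum f r + bohr_area f r) \<le> lam * ((1 - a\<^sup>2) * (r / (1 - r)))"
    using bohr_sum_area_le[OF f r(1) r(4)] lam unfolding a0 by (intro mult_left_mono) auto
  moreover have "cmod (f (w z)) powr p + p / 2 * ((1 - a\<^sup>2) * ((1 - t) / (1 + t))) \<le> 1"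
    using schwarz_pick_bound[OF f, of "w z"] a t p
    by (intro powr_moebius_bound) (auto simp: a_def t_def)
  ultimately show ?thesis unfolding bohr_E_def r_def by (simp add: mult_ac)
qed

section \<open>Extremal functions and sharpness\<close>

text \<open>Comparing coefficients in (1 + a z) f(z) = a + z gives a recursion whose solution makes
  \<open>bohr_sum\<close> a geometric series.\<close>

lemma moebius_schur:
  fixes a :: real
  assumes a: "0 < a" "a < 1"
  defines "f \<equiv> \<lambda>z. (of_real a + z) / (1 + of_real a * z)"
  shows "f \<in> schur_class" and "0 \<le> r \<Longrightarrow> r < 1 \<Longrightarrow> bohr_sum f r = (1 - a\<^sup>2) * (r / (1 - a * r))"
proof -
  have nz: "1 + of_real a * z \<noteq> 0" if "cmod z < 1" for z :: complex
  proof
    assume "1 + of_real a * z = 0"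
    then have "cmod (of_real a * z) = 1" by (metis add_eq_0_iff norm_minus_cancel norm_one)
    then have "a * cmod z = 1" using a by (simp add: norm_mult)
    moreover have "a * cmod z < 1 * 1" using a that by (intro mult_strict_mono') auto
    ultimately show False by simp
  qed
  have hol: "f holomorphic_on ball 0 1"
    unfolding f_def by (intro holomorphic_intros) (use nz in auto)
  have "cmod (f z) \<le> 1" if "cmod z < 1" for z
    using moebius_bound[of "- of_real a" z] nz[OF that] a that
    by (simp add: f_def norm_divide divide_le_eq add.commute)
  with hol show fs: "f \<in> schur_class" by (auto simp: schur_class_iff_holomorphic)
  have "f has_fps_expansion fps_expansion f 0"
    using hol by (intro has_fps_expansion_fps_expansion[of "ball 0 1"]) auto
  then have "(\<lambda>z. (1 + of_real a * z) * f z) has_fps_expansion (1 + fps_const (of_real a) * fps_X) * fps_expansion f 0"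
    by (intro fps_expansion_intros)
  moreover have "\<forall>\<^sub>F z in nhds 0. (1 + of_real a * z) * f z = of_real a + z"
    using eventually_nhds_in_open[OF open_ball centre_in_ball[THEN iffD2, OF zero_less_one], of "0::complex"]
    by eventually_elim (use nz in \<open>auto simp: f_def\<close>)
  ultimately have "(\<lambda>z. of_real a + z) has_fps_expansion (1 + fps_const (of_real a) * fps_X) * fps_expansion f 0"
    by (subst (asm) has_fps_expansion_cong) auto
  moreover have "(\<lambda>z. of_real a + z) has_fps_expansion fps_const (of_real a) + fps_X"
    by (intro fps_expansion_intros)
  ultimately have eq: "(1 + fps_const (of_real a) * fps_X) * fps_expansion f 0 = fps_const (of_real a) + fps_X"
    by (rule fps_expansion_unique_complex)
  have coeff: "fps_nth (fps_expansion f 0) n + (if n = 0 then 0 else of_real a * fps_nth (fps_expansion f 0) (n - 1))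
      = (if n = 0 then of_real a else if n = 1 then 1 else 0)" for n
    using arg_cong[OF eq, of "\<lambda>F. fps_nth F n"] by (auto simp: distrib_right mult.assoc)
  have c0: "taylor_coeff f 0 = of_real a" using coeff[of 0] by (simp add: taylor_coeff_def)
  have cn: "taylor_coeff f (Suc n) = of_real ((1 - a\<^sup>2) * (- a) ^ n)" for n
  proof (induction n)
    case 0
    show ?case using coeff[of 1] c0
      by (simp add: taylor_coeff_def power2_eq_square eq_diff_eq)
  next
    case (Suc n)
    have "taylor_coeff f (Suc (Suc n)) = - of_real a * taylor_coeff f (Suc n)"
      using coeff[of "Suc (Suc n)"] by (simp add: taylor_coeff_def eq_neg_iff_add_eq_0)
    then show ?case unfolding Suc by simp
  qed
  assume r: "0 \<le> r" "r < 1"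
  have ar: "a * r < 1" using a r mult_le_one[of a r] mult_strict_mono'[of a 1 r 1] by simp
  have "cmod (taylor_coeff f (Suc n)) * r ^ Suc n = (1 - a\<^sup>2) * r * (a * r) ^ n" for n
  proof -
    have "cmod (taylor_coeff f (Suc n)) = (1 - a\<^sup>2) * a ^ n"
      unfolding cn norm_of_real using a by (simp add: abs_mult power_abs abs_square_le_1)
    then show ?thesis by (simp add: power_mult_distrib)
  qed
  moreover have "(\<lambda>n. (1 - a\<^sup>2) * r * (a * r) ^ n) sums ((1 - a\<^sup>2) * r * (1 / (1 - a * r)))"
    using ar a r by (intro sums_mult geometric_sums) simp
  ultimately have "bohr_sum f r = (1 - a\<^sup>2) * r * (1 / (1 - a * r))"
    unfolding bohr_sum_def by (simp only: sums_unique[symmetric])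
  then show "bohr_sum f r = (1 - a\<^sup>2) * (r / (1 - a * r))" by simp
qed

lemma power_schur_class_order:
  assumes "1 \<le> m"
  shows "(\<lambda>z. z ^ m) \<in> schur_class_order m"
proof -
  have "(deriv ^^ k) (\<lambda>z::complex. z ^ m) 0 = fact k * fps_nth (fps_X ^ m) k" for k
    using fps_nth_fps_expansion[OF has_fps_expansion_fps_X_power, of m k] by simp
  then show ?thesis
    by (auto simp: schur_class_order_def schur_class_iff_holomorphic norm_power fps_X_power_nth
      intro!: holomorphic_intros power_le_one)
qed

lemma bohr_radius_sharp:
  fixes p lam r :: real
  assumes p: "0 < p" and lam: "0 < lam" and r: "0 < r" "r < 1" and m: "1 \<le> m"
    and neg: "p * ((1 - r ^ m) / (1 + r ^ m)) - 2 * lam * (r / (1 - r)) < 0"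
  shows "\<exists>f\<in>schur_class. \<exists>w\<in>schur_class_order m. bohr_E p lam f w (of_real r) > 1"
proof -
  define q where "q = r ^ m"
  have q: "0 < q" using r by (simp add: q_def)
  \<comment> \<open>\<open>G a\<close> is the value of E at z = r for the Moebius function with
    parameter a, without the area term. \<open>G 1\<close> is 1.\<close>
  define G where "G a = ((a + q) / (1 + a * q)) powr p + lam * ((1 - a\<^sup>2) * (r / (1 - a * r)))" for a
  have "((\<lambda>a. (a + q) / (1 + a * q)) has_real_derivative (1 - q) / (1 + q)) (at 1)"
    using q by (auto intro!: derivative_eq_intros simp: divide_simps) (simp add: algebra_simps)
  then have "((\<lambda>a. ((a + q) / (1 + a * q)) powr p) has_real_derivative
      p * ((1 + q) / (1 + 1 * q)) powr (p - of_nat 1) * ((1 - q) / (1 + q))) (at 1)"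
    by (rule DERIV_fun_powr) (use q in auto)
  moreover have "p * ((1 + q) / (1 + 1 * q)) powr (p - of_nat 1) * ((1 - q) / (1 + q)) = p * ((1 - q) / (1 + q))"
    using q by simp
  ultimately have D1: "((\<lambda>a. ((a + q) / (1 + a * q)) powr p) has_real_derivative p * ((1 - q) / (1 + q))) (at 1)"
    by (simp only:)
  have D2: "((\<lambda>a. (1 - a\<^sup>2) * (r / (1 - a * r))) has_real_derivative - 2 * (r / (1 - r))) (at 1)"
    using r by (auto intro!: derivative_eq_intros simp: divide_simps)
  have "(G has_real_derivative p * ((1 - q) / (1 + q)) - 2 * lam * (r / (1 - r))) (at 1)"
    unfolding G_def using DERIV_add[OF D1 DERIV_cmult[OF D2, of lam]] by (rule DERIV_cong) simp
  \<comment> \<open>The derivative at 1 is the radius function at r, so its negative sign makes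
    \<open>G\<close> exceed 1 just left of 1.\<close>
  from DERIV_neg_dec_left[OF this] neg obtain d where d: "d > 0"
    "\<And>h. 0 < h \<Longrightarrow> h < d \<Longrightarrow> G 1 < G (1 - h)"
    unfolding q_def by blast
  define h where "h = min (d / 2) (1 / 2)"
  define a where "a = 1 - h"
  have h: "0 < h" "h < d" "h < 1" using d by (auto simp: h_def)
  have a: "0 < a" "a < 1" using h by (auto simp: a_def)
  define f where "f = (\<lambda>z. (complex_of_real a + z) / (1 + of_real a * z))"
  have f: "f \<in> schur_class" and B: "bohr_sum f r = (1 - a\<^sup>2) * (r / (1 - a * r))"
    using moebius_schur[OF a] r unfolding f_def by auto
  have "f (of_real r ^ m) = of_real ((a + q) / (1 + a * q))" by (simp add: f_def q_def)
  then have "cmod (f (of_real r ^ m)) = \<bar>(a + q) / (1 + a * q)\<bar>" by (simp only: norm_of_real)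
  also have "\<dots> = (a + q) / (1 + a * q)" using a q by simp
  finally have "bohr_E p lam f (\<lambda>z. z ^ m) (of_real r) = G a + lam * bohr_area f r"
    using r B by (simp add: bohr_E_def G_def algebra_simps)
  moreover have "0 \<le> lam * bohr_area f r" using bohr_area_nonneg[OF f, of r] r lam by simp
  moreover have "1 < G a" using d(2)[OF h(1,2)] q by (simp add: G_def a_def)
  ultimately have "1 < bohr_E p lam f (\<lambda>z. z ^ m) (of_real r)" by linarith
  then show ?thesis using f power_schur_class_order[OF m] by blast
qed

theorem theorem5:
  fixes m :: nat and p lam :: real
  assumes "1 \<le> m" and "0 < p" and "p \<le> 2" and "0 < lam"
  shows "radius_root p lam m (bohr_radius p lam m)
    \<and> (\<forall>r. radius_root p lam m r \<longrightarrow> bohr_radius p lam m \<le> r)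
    \<and> (\<forall>f\<in>schur_class. \<forall>\<omega>\<in>schur_class_order m. \<forall>z\<in>ball 0 1.
          cmod z \<le> bohr_radius p lam m \<longrightarrow> bohr_E p lam f \<omega> z \<le> 1)
    \<and> (\<forall>R'. bohr_radius p lam m < R' \<and> R' \<le> 1 \<longrightarrow>
          (\<exists>f\<in>schur_class. \<exists>\<omega>\<in>schur_class_order m. \<exists>z\<in>ball 0 1.
             cmod z < R' \<and> bohr_E p lam f \<omega> z > 1))"
proof -
  obtain R where R: "radius_root p lam m R"
    using radius_root_exists assms by blast
  have unique: "s = R" if "radius_root p lam m s" for s
    using radius_root_unique assms R that by blast
  \<comment> \<open>Over the reals \<open>LEAST\<close> is meaningful only if a minimum exists; here
    the root is unique.\<close>
  have eq: "bohr_radius p lam m = R"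
    unfolding bohr_radius_def
  proof (rule Least_equality)
    show "R \<le> s" if "radius_root p lam m s" for s using unique[OF that] by simp
  qed (rule R)
  have sharp: "\<exists>f\<in>schur_class. \<exists>\<omega>\<in>schur_class_order m. \<exists>z\<in>ball 0 1. cmod z < R' \<and> bohr_E p lam f \<omega> z > 1"
    if R': "R < R'" "R' \<le> 1" for R'
  proof -
    \<comment> \<open>The midpoint stays below 1 even when R' = 1.\<close>
    define r where "r = (R + R') / 2"
    have r: "R < r" "r < R'" "0 < r" "r < 1" using R R' by (auto simp: r_def radius_root_def)
    have "p * ((1 - r ^ m) / (1 + r ^ m)) - 2 * lam * (r / (1 - r)) < 0"
      using radius_function_strict_antimono[of p lam R r m] assms R r by (auto simp: radius_root_def)
    from bohr_radius_sharp[OF _ _ r(3,4) _ this] assms obtain f \<omega> where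
      "f \<in> schur_class" "\<omega> \<in> schur_class_order m" "bohr_E p lam f \<omega> (of_real r) > 1" by blast
    moreover have "complex_of_real r \<in> ball 0 1" "cmod (complex_of_real r) < R'" using r by auto
    ultimately show ?thesis by blast
  qed
  show ?thesis
    unfolding eq
  proof (intro conjI allI impI ballI)
    show "radius_root p lam m R" by (rule R)
    show "R \<le> s" if "radius_root p lam m s" for s using unique[OF that] by simp
    show "bohr_E p lam f \<omega> z \<le> 1" if "f \<in> schur_class" "\<omega> \<in> schur_class_order m" "cmod z \<le> R" for f \<omega> z
      by (rule bohr_E_le_1[OF that(1,2) assms R that(3)])
    show "\<exists>f\<in>schur_class. \<exists>\<omega>\<in>schur_class_order m. \<exists>z\<in>ball 0 1. cmod z < R' \<and> bohr_E p lam f \<omega> z > 1"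
      if "R < R' \<and> R' \<le> 1" for R'
      using that by (intro sharp) auto
  qed
qed

end
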